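(* Let $k$ be a field with algebraic closure $\overline{k}$, let $f\in k[x]$ be nonzero, and let $n:=\deg(f)$. Over $\overline{k}$, write $f=a_n\prod_{i=1}^s(x-r_i)^{m_i}$ with $r_1,\ldots,r_s$ distinct and $m_i\geq 1$. For any $\alpha\in k-\{0\}$, we have $$\operatorname{tol}(f(\alpha x))=\alpha^{n^2-2n+\sum_{i=1}^s m_i^2}\operatorname{tol}(f(x)).$$
   Context: For a nonzero polynomial $f\in k[x]$ of degree $n$ with leading coefficient $a_n$ and factorization $f=a_n\prod_{i=1}^s(x-r_i)^{m_i}$ over $\overline{k}$, where $r_1,\ldots,r_s$ are distinct and $m_i\geq 1$, the tolerant of $f$ is $\operatorname{tol}(f):=a_n^{2n-2}\prod_{1\leq i<j\leq s}(r_i-r_j)^{2m_im_j}$. *)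

theory Defs
  imports "HOL-Algebra.Algebraic_Closure_Type"
begin

text \<open>
  The algebraic closure of the field \<^typ>\<open>'a\<close> is the library type \<^typ>\<open>'a alg_closure\<close>, with
  embedding \<^const>\<open>to_ac\<close>. Roots and multiplicities are indexed by \<open>1, \<dots>, s\<close>; the values of
  \<open>r\<close> and \<open>m\<close> at other indices are irrelevant.
\<close>

definition root_factorization ::
    "'a::field poly \<Rightarrow> nat \<Rightarrow> (nat \<Rightarrow> 'a alg_closure) \<Rightarrow> (nat \<Rightarrow> nat) \<Rightarrow> bool" where
  "root_factorization f s r m \<longleftrightarrow>
     map_poly to_ac f = smult (to_ac (lead_coeff f)) (\<Prod>i=1..s. [:- r i, 1:] ^ m i) \<and>
     inj_on r {1..s} \<and> (\<forall>i\<in>{1..s}. m i \<ge> 1)"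

text \<open>
  The exponent \<open>2 * n - 2\<close> is an integer because it is negative when \<open>n = 0\<close>. The value is only
  meaningful for \<open>f \<noteq> 0\<close>; it is then independent of the enumeration of the roots
  (lemma \<open>tol_eq\<close>), and an enumeration always exists (lemma \<open>root_factorization_exists\<close>).
\<close>

definition tol :: "'a::field poly \<Rightarrow> 'a alg_closure" where
  "tol f = (THE t. \<exists>s r m. root_factorization f s r m \<and>
     t = to_ac (lead_coeff f) powi (2 * int (degree f) - 2) *
         (\<Prod>(i, j)\<in>{(i, j). 1 \<le> i \<and> i < j \<and> j \<le> s}. (r i - r j) ^ (2 * m i * m j)))"

lemma root_factorization_exists:
  fixes f :: "'a::field poly"
  assumes "f \<noteq> 0"
  shows "\<exists>s r m. root_factorization f s r m"
proof -
  define g where "g = map_poly to_ac f"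
  have lc: "lead_coeff g = to_ac (lead_coeff f)" and g0: "g \<noteq> 0"
    using assms unfolding g_def by (auto simp: degree_map_poly coeff_map_poly map_poly_eq_0_iff)
  obtain A where A: "g = smult (lead_coeff g) (\<Prod>x\<in>#A. [:-x, 1:])"
    using alg_closed_imp_factorization[OF g0] by auto
  obtain h where h: "bij_betw h {1..card (set_mset A)} (set_mset A)"
    using ex_bij_betw_nat_finite_1[of "set_mset A"] by auto
  have "(\<Prod>x\<in>#A. [:-x, 1:]) = (\<Prod>x\<in>set_mset A. [:-x, 1:] ^ count A x)"
    by (simp add: image_prod_mset_multiplicity)
  also have "\<dots> = (\<Prod>i=1..card (set_mset A). [:- h i, 1:] ^ count A (h i))"
    using prod.reindex_bij_betw[OF h, of "\<lambda>x. [:-x, 1:] ^ count A x"] by simp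
  finally have "g = smult (to_ac (lead_coeff f))
      (\<Prod>i=1..card (set_mset A). [:- h i, 1:] ^ count A (h i))"
    using A lc by simp
  moreover have "\<forall>i\<in>{1..card (set_mset A)}. count A (h i) \<ge> 1"
    using h by (auto simp: bij_betw_def Suc_le_eq count_greater_zero_iff)
  ultimately have "root_factorization f (card (set_mset A)) h (\<lambda>i. count A (h i))"
    using h unfolding root_factorization_def g_def bij_betw_def by blast
  thus ?thesis by blast
qed

lemma root_factorization_proots:
  fixes f :: "'a::field poly"
  assumes "f \<noteq> 0" and fac: "root_factorization f s r m"
  defines "A \<equiv> proots (map_poly to_ac f)"
  shows "set_mset A = r ` {1..s}" and "i \<in> {1..s} \<Longrightarrow> count A (r i) = m i"
proof -
  have inj: "inj_on r {1..s}" and pos: "\<And>i. i \<in> {1..s} \<Longrightarrow> m i \<ge> 1"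
    and eq: "map_poly to_ac f = smult (to_ac (lead_coeff f)) (\<Prod>i=1..s. [:- r i, 1:] ^ m i)"
    using fac unfolding root_factorization_def by auto
  have "to_ac (lead_coeff f) \<noteq> 0" using assms(1) by simp
  hence A_eq: "A = (\<Sum>i=1..s. repeat_mset (m i) {#r i#})"
    unfolding A_def eq by (simp add: proots_prod proots_power)
  have cnt: "count A x = (\<Sum>i=1..s. if r i = x then m i else 0)" for x
    unfolding A_eq count_sum by (rule sum.cong) auto
  have c: "count A (r i) = m i" if i: "i \<in> {1..s}" for i
  proof -
    have "(\<Sum>j=1..s. if r j = r i then m j else 0) = (\<Sum>j=1..s. if j = i then m j else 0)"
      using inj_on_eq_iff[OF inj _ i] by (intro sum.cong refl if_cong) simp_all
    also have "\<dots> = m i" using i by simp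
    finally show ?thesis unfolding cnt .
  qed
  thus "count A (r i) = m i" if "i \<in> {1..s}" using that .
  show "set_mset A = r ` {1..s}"
  proof (intro equalityI subsetI)
    fix x assume "x \<in># A"
    hence "count A x \<noteq> 0" by simp
    hence "\<exists>i\<in>{1..s}. r i = x" unfolding cnt by (rule contrapos_np) (auto intro!: sum.neutral)
    thus "x \<in> r ` {1..s}" by blast
  next
    fix x assume "x \<in> r ` {1..s}"
    then obtain i where "i \<in> {1..s}" "x = r i" by blast
    with c pos have "count A x \<ge> 1" by simp
    thus "x \<in># A" by (simp add: Suc_le_eq)
  qed
qed

lemma prod_pairs_eq:
  fixes r :: "nat \<Rightarrow> 'b::field" and M :: "'b \<Rightarrow> nat"
  assumes inj: "inj_on r {1..s}"
  defines "P \<equiv> {(i, j). 1 \<le> i \<and> i < j \<and> j \<le> s}"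
  shows "(\<Prod>(i, j)\<in>P. (r i - r j) ^ (2 * M (r i) * M (r j))) =
         (\<Prod>B\<in>{B. B \<subseteq> r ` {1..s} \<and> card B = 2}.
            THE v. \<exists>x y. B = {x, y} \<and> v = (x - y) ^ (2 * M x * M y))"
proof -
  define F where "F = (\<lambda>x y. (x - y) ^ (2 * M x * M y))"
  define G where "G = (\<lambda>B. THE v. \<exists>x y. B = {x, y} \<and> v = F x y)"
  have sym: "F x y = F y x" for x y
    unfolding F_def by (metis (no_types) power2_commute power_mult mult.assoc mult.commute)
  have G: "G {x, y} = F x y" for x y
    unfolding G_def by (rule the_equality) (use sym in \<open>auto simp: doubleton_eq_iff\<close>)
  have bij: "bij_betw (\<lambda>(i, j). {r i, r j}) P {B. B \<subseteq> r ` {1..s} \<and> card B = 2}"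
  proof (rule bij_betwI')
    fix p q assume pq: "p \<in> P" "q \<in> P"
    obtain i j where p: "p = (i, j)" by (cases p)
    obtain k l where q: "q = (k, l)" by (cases q)
    have ij: "i \<in> {1..s}" "j \<in> {1..s}" "i < j" and kl: "k \<in> {1..s}" "l \<in> {1..s}" "k < l"
      using pq unfolding P_def p q by auto
    have "{r i, r j} = {r k, r l} \<Longrightarrow> i = k \<and> j = l"
      using ij kl inj_on_eq_iff[OF inj] by (metis doubleton_eq_iff less_asym)
    thus "((case p of (i, j) \<Rightarrow> {r i, r j}) = (case q of (i, j) \<Rightarrow> {r i, r j})) = (p = q)"
      unfolding p q by auto
  next
    fix p assume "p \<in> P"
    then obtain i j where p: "p = (i, j)" "i \<in> {1..s}" "j \<in> {1..s}" "i < j"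
      unfolding P_def by auto
    hence "r i \<noteq> r j" using inj_on_eq_iff[OF inj] by auto
    thus "(case p of (i, j) \<Rightarrow> {r i, r j}) \<in> {B. B \<subseteq> r ` {1..s} \<and> card B = 2}"
      using p by auto
  next
    fix B assume "B \<in> {B. B \<subseteq> r ` {1..s} \<and> card B = 2}"
    then obtain x y where B: "B = {x, y}" "x \<noteq> y" "x \<in> r ` {1..s}" "y \<in> r ` {1..s}"
      by (auto simp: card_2_iff)
    then obtain i j where ij: "i \<in> {1..s}" "j \<in> {1..s}" "x = r i" "y = r j" by blast
    with B have "i \<noteq> j" by auto
    thus "\<exists>p\<in>P. B = (case p of (i, j) \<Rightarrow> {r i, r j})"
    proof (cases "i < j")
      case True
      thus ?thesis using B ij by (intro bexI[of _ "(i, j)"]) (auto simp: P_def)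
    next
      case False
      with \<open>i \<noteq> j\<close> show ?thesis using B ij by (intro bexI[of _ "(j, i)"]) (auto simp: P_def)
    qed
  qed
  have "(\<Prod>(i, j)\<in>P. F (r i) (r j)) = (\<Prod>p\<in>P. G (case p of (i, j) \<Rightarrow> {r i, r j}))"
    by (intro prod.cong) (auto simp: G)
  also have "\<dots> = (\<Prod>B\<in>{B. B \<subseteq> r ` {1..s} \<and> card B = 2}. G B)"
    by (rule prod.reindex_bij_betw[OF bij])
  finally show ?thesis unfolding F_def G_def .
qed

lemma tol_eq:
  fixes f :: "'a::field poly"
  assumes "f \<noteq> 0" and fac: "root_factorization f s r m"
  shows "tol f = to_ac (lead_coeff f) powi (2 * int (degree f) - 2) *
         (\<Prod>(i, j)\<in>{(i, j). 1 \<le> i \<and> i < j \<and> j \<le> s}. (r i - r j) ^ (2 * m i * m j))"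
proof -
  define A where "A = proots (map_poly to_ac f)"
  have canon: "(\<Prod>(i, j)\<in>{(i, j). 1 \<le> i \<and> i < j \<and> j \<le> s}. (r i - r j) ^ (2 * m i * m j)) =
      (\<Prod>B\<in>{B. B \<subseteq> set_mset A \<and> card B = 2}.
         THE v. \<exists>x y. B = {x, y} \<and> v = (x - y) ^ (2 * count A x * count A y))"
    if "root_factorization f s r m" for s r m
  proof -
    note pr = root_factorization_proots[OF assms(1) that, folded A_def]
    have inj: "inj_on r {1..s}" using that unfolding root_factorization_def by blast
    have "(\<Prod>(i, j)\<in>{(i, j). 1 \<le> i \<and> i < j \<and> j \<le> s}. (r i - r j) ^ (2 * m i * m j)) =
      (\<Prod>(i, j)\<in>{(i, j). 1 \<le> i \<and> i < j \<and> j \<le> s}.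
        (r i - r j) ^ (2 * count A (r i) * count A (r j)))"
      by (intro prod.cong) (auto simp: pr(2))
    also note prod_pairs_eq[OF inj]
    finally show ?thesis unfolding pr(1) .
  qed
  show ?thesis
    unfolding tol_def
  proof (rule the_equality, goal_cases)
    case 1
    show ?case using fac by blast
  next
    case (2 t)
    then show ?case unfolding canon[OF fac] using canon by (elim exE conjE) (simp only:)
  qed
qed

end

theory Submission
  imports Defs
begin

text \<open>
  The polynomial \<open>f(\<alpha> x)\<close> has the same multiplicities \<open>m\<^sub>i\<close> as \<open>f\<close>, roots \<open>r\<^sub>i / \<alpha>\<close>, degree
  \<open>n\<close> and leading coefficient \<open>a\<^sub>n \<alpha>\<^sup>n\<close>. The leading coefficient therefore contributes
  \<open>n (2 n - 2)\<close> to the exponent of \<open>\<alpha>\<close>, and the root differences contribute minus the sum of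
  \<open>2 m\<^sub>i m\<^sub>j\<close> over \<open>i < j\<close>. Expanding the square of \<open>n = m\<^sub>1 + \<dots> + m\<^sub>s\<close> shows that this last sum
  is \<open>n\<^sup>2\<close> minus the sum of the \<open>m\<^sub>i\<^sup>2\<close>, which gives the stated exponent. The two ingredients
  are \<open>root_factorization_rescale\<close> and \<open>sum_double_products_eq\<close>.
\<close>

lemma degree_root_factorization:
  assumes "f \<noteq> 0" and "root_factorization f s r m"
  shows "degree f = (\<Sum>i=1..s. m i)"
proof -
  have "degree f = degree (map_poly to_ac f)"
    by (simp add: degree_map_poly)
  also have "\<dots> = degree (\<Prod>i=1..s. [:- r i, 1:] ^ m i)"
    using assms unfolding root_factorization_def by simp
  also have "\<dots> = (\<Sum>i=1..s. degree ([:- r i, 1:] ^ m i))"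
    by (rule degree_prod_eq_sum_degree) simp
  finally show ?thesis
    by (simp add: degree_linear_power)
qed

text \<open>
  Each linear factor obeys \<open>\<alpha> x - r\<^sub>i = \<alpha> (x - r\<^sub>i / \<alpha>)\<close>; the powers of \<open>\<alpha>\<close> taken out in this way
  multiply up to the power that the leading coefficient gains.
\<close>

lemma root_factorization_rescale:
  assumes "f \<noteq> 0" and fac: "root_factorization f s r m" and "\<alpha> \<noteq> 0"
  shows "root_factorization (pcompose f [:0, \<alpha>:]) s (\<lambda>i. r i / to_ac \<alpha>) m"
proof -
  define a where "a = to_ac \<alpha>"
  have a: "a \<noteq> 0"
    using \<open>\<alpha> \<noteq> 0\<close> by (simp add: a_def)
  have lc: "to_ac (lead_coeff (pcompose f [:0, \<alpha>:])) = to_ac (lead_coeff f) * a ^ (\<Sum>i=1..s. m i)"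
    using \<open>\<alpha> \<noteq> 0\<close> degree_root_factorization[OF assms(1,2)]
    by (subst lead_coeff_comp) (simp_all add: a_def)
  have factor: "pcompose ([:- r i, 1:] ^ m i) [:0, a:] = smult (a ^ m i) ([:- (r i / a), 1:] ^ m i)" for i
  proof -
    have "pcompose ([:- r i, 1:] ^ m i) [:0, a:] = pcompose [:- r i, 1:] [:0, a:] ^ m i"
      using pcompose_prod[of "\<lambda>_. [:- r i, 1:]" "{..<m i}" "[:0, a:]"]
      unfolding prod_constant card_lessThan .
    also have "pcompose [:- r i, 1:] [:0, a:] = smult a [:- (r i / a), 1:]"
      using a by (simp add: pcompose_pCons)
    finally show ?thesis
      unfolding smult_power .
  qed
  have "map_poly to_ac (pcompose f [:0, \<alpha>:]) = pcompose (map_poly to_ac f) [:0, a:]"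
    by (rule poly_eqI) (simp add: coeff_map_poly coeff_pcompose_linear a_def)
  also have "\<dots> = smult (to_ac (lead_coeff f)) (\<Prod>i=1..s. pcompose ([:- r i, 1:] ^ m i) [:0, a:])"
    using fac unfolding root_factorization_def by (simp add: pcompose_smult pcompose_prod)
  also have "\<dots> = smult (to_ac (lead_coeff f) * a ^ (\<Sum>i=1..s. m i)) (\<Prod>i=1..s. [:- (r i / a), 1:] ^ m i)"
    unfolding factor by (simp add: prod_smult power_sum)
  finally have "map_poly to_ac (pcompose f [:0, \<alpha>:])
      = smult (to_ac (lead_coeff f) * a ^ (\<Sum>i=1..s. m i)) (\<Prod>i=1..s. [:- (r i / a), 1:] ^ m i)" .
  moreover have "inj_on (\<lambda>i. r i / a) {1..s}"
  proof (rule inj_onI)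
    fix i j assume ij: "i \<in> {1..s}" "j \<in> {1..s}" and "r i / a = r j / a"
    hence "r i = r j"
      using a by simp
    moreover have "inj_on r {1..s}"
      using fac unfolding root_factorization_def by blast
    ultimately show "i = j"
      using ij by (blast dest: inj_onD)
  qed
  ultimately show ?thesis
    using fac unfolding root_factorization_def lc a_def[symmetric] by blast
qed

text \<open>
  The square of the sum is split into its diagonal and off-diagonal terms. The identity is
  additive, so that it applies to the multiplicities as natural numbers, without subtraction.
\<close>

lemma sum_double_products_eq:
  fixes m :: "nat \<Rightarrow> 'b::comm_semiring_1"
  shows "(\<Sum>(i, j)\<in>{(i, j). 1 \<le> i \<and> i < j \<and> j \<le> s}. 2 * m i * m j) + (\<Sum>i=1..s. (m i)\<^sup>2)
       = (\<Sum>i=1..s. m i)\<^sup>2"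
proof -
  have "{(i, j). 1 \<le> i \<and> i < j \<and> j \<le> s} = prod.swap ` (SIGMA j:{1..s}. {1..<j})"
    by (auto simp: image_iff)
  hence "(\<Sum>(i, j)\<in>{(i, j). 1 \<le> i \<and> i < j \<and> j \<le> s}. 2 * m i * m j)
       = (\<Sum>j=1..s. \<Sum>i=1..<j. 2 * m i * m j)"
    by (simp add: sum.reindex inj_on_def sum.Sigma case_prod_unfold)
  moreover have "(\<Sum>j=1..s. \<Sum>i=1..<j. 2 * m i * m j) + (\<Sum>i=1..s. (m i)\<^sup>2) = (\<Sum>i=1..s. m i)\<^sup>2"
  proof (induction s)
    case (Suc s)
    define S where "S = (\<Sum>i=1..s. m i)"
    have "(\<Sum>i=1..<Suc s. 2 * m i * m (Suc s)) = 2 * S * m (Suc s)"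
      unfolding S_def atLeastLessThanSuc_atLeastAtMost sum_distrib_left sum_distrib_right ..
    hence "(\<Sum>j=1..Suc s. \<Sum>i=1..<j. 2 * m i * m j) + (\<Sum>i=1..Suc s. (m i)\<^sup>2)
        = ((\<Sum>j=1..s. \<Sum>i=1..<j. 2 * m i * m j) + (\<Sum>i=1..s. (m i)\<^sup>2))
          + 2 * S * m (Suc s) + (m (Suc s))\<^sup>2"
      by (simp only: sum.nat_ivl_Suc' le_add1 plus_1_eq_Suc ac_simps)
    also have "\<dots> = (S + m (Suc s))\<^sup>2"
      unfolding Suc.IH S_def[symmetric] by (simp add: power2_sum ac_simps)
    finally show ?case
      by (simp add: S_def)
  qed simp
  ultimately show ?thesis
    by simp
qed

theorem proposition2p2:
  fixes f :: "'a::field poly" and \<alpha> :: 'a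
    and s :: nat and r :: "nat \<Rightarrow> 'a alg_closure" and m :: "nat \<Rightarrow> nat"
  assumes "f \<noteq> 0"
    and "root_factorization f s r m"
    and "\<alpha> \<noteq> 0"
  shows "tol (pcompose f [:0, \<alpha>:]) =
    to_ac \<alpha> powi ((int (degree f))\<^sup>2 - 2 * int (degree f) + (\<Sum>i=1..s. (int (m i))\<^sup>2)) * tol f"
proof -
  define a where "a = to_ac \<alpha>"
  define n where "n = degree f"
  define P where "P = {(i, j). 1 \<le> i \<and> i < j \<and> j \<le> s}"
  define K where "K = (\<Sum>(i, j)\<in>P. 2 * m i * m j)"
  define D where "D = (\<Prod>(i, j)\<in>P. (r i - r j) ^ (2 * m i * m j))"
  define c where "c = to_ac (lead_coeff f)"
  have a: "a \<noteq> 0"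
    using assms(3) by (simp add: a_def)
  have g: "pcompose f [:0, \<alpha>:] \<noteq> 0" "degree (pcompose f [:0, \<alpha>:]) = n"
    using assms(1,3) by (simp_all add: pcompose_eq_0_iff degree_pcompose n_def)
  have lc: "to_ac (lead_coeff (pcompose f [:0, \<alpha>:])) = c * a ^ n"
    using assms(3) by (subst lead_coeff_comp) (simp_all add: a_def c_def n_def)
  have "int K + (\<Sum>i=1..s. (int (m i))\<^sup>2) = (int n)\<^sup>2"
    using arg_cong[OF sum_double_products_eq[of m s], of int] degree_root_factorization[OF assms(1,2)]
    by (simp add: K_def P_def n_def)
  hence exponent: "int n * (2 * int n - 2) - int K
      = (int n)\<^sup>2 - 2 * int n + (\<Sum>i=1..s. (int (m i))\<^sup>2)"
    by (simp add: algebra_simps power2_eq_square)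
  have "(\<Prod>(i, j)\<in>P. (r i / a - r j / a) ^ (2 * m i * m j))
      = (\<Prod>(i, j)\<in>P. (r i - r j) ^ (2 * m i * m j) / a ^ (2 * m i * m j))"
    by (intro prod.cong) (auto simp: power_divide simp flip: diff_divide_distrib)
  also have "\<dots> = D / a ^ K"
    by (simp add: D_def K_def prod_dividef power_sum case_prod_unfold)
  finally have "tol (pcompose f [:0, \<alpha>:]) = (c * a ^ n) powi (2 * int n - 2) * (D / a ^ K)"
    using tol_eq[OF g(1) root_factorization_rescale[OF assms]]
    unfolding lc unfolding g(2) a_def[symmetric] P_def[symmetric] by simp
  also have "(c * a ^ n) powi (2 * int n - 2) = c powi (2 * int n - 2) * a powi (int n * (2 * int n - 2))"
    by (simp only: power_int_mult_distrib power_int_mult power_int_of_nat)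
  also have "\<dots> * (D / a ^ K) = a powi (int n * (2 * int n - 2) - int K) * (c powi (2 * int n - 2) * D)"
    using power_int_diff[of a "int n * (2 * int n - 2)" "int K"] a by (simp only: power_int_of_nat) simp
  also have "c powi (2 * int n - 2) * D = tol f"
    using tol_eq[OF assms(1,2)] by (simp add: c_def n_def D_def P_def)
  finally show ?thesis
    unfolding exponent unfolding a_def n_def .
qed

end
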